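(* Let $\mathcal{C}$ be a (small) category. The nerve $N\mathcal{C}$ admits a duplicial structure if and only if $\mathcal{C}$ has a coreflective subcategory which is a groupoid.
   Context: A coreflective subcategory is a subcategory whose inclusion functor has a right adjoint. The nerve $N\mathcal{C}$ is the simplicial set whose set of $n$-simplices is the set of composable $n$-tuples $A_0\xrightarrow{f_0}A_1\xrightarrow{f_1}\cdots\xrightarrow{f_{n-1}}A_n$ of morphisms of $\mathcal{C}$ (objects of $\mathcal{C}$ when $n=0$), written $(f_{n-1},\dots,f_0)$. For $0\le i\le n$, the face map $d_i$ sends it to $(f_{n-1},\dots,f_1)$ if $i=0$, to $(f_{n-1},\dots,f_if_{i-1},\dots,f_0)$ if $0<i<n$, and to $(f_{n-2},\dots,f_0)$ if $i=n$ (for $n=1$: $d_0(f_0)=A_1$, $d_1(f_0)=A_0$); the degeneracy map is $s_i(f_{n-1},\dots,f_0)=(f_{n-1},\dots,f_i,1,f_{i-1},\dots,f_0)$. A duplicial structure on a simplicial object $X$ consists of a morphism $t\colon X_n\to X_n$ for each $n\ge 0$ such that $$d_it=\begin{cases} t d_{i-1} & 1\le i\le n\\ d_n & i=0\end{cases}\ (n\ge 1),\qquad s_jt=\begin{cases} t s_{j-1} & 1\le j\le n\\ t^2s_n & j=0\end{cases}\ (n\ge 0)$$ (on $X_n$). No invertibility of $t$ is required. *)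

theory Defs
  imports Main
begin

section \<open>Small categories\<close>

record ('o, 'm) cat =
  Obj :: "'o set"
  Arr :: "'m set"
  Dom :: "'m \<Rightarrow> 'o"
  Cod :: "'m \<Rightarrow> 'o"
  Ident :: "'o \<Rightarrow> 'm"
  Comp :: "'m \<Rightarrow> 'm \<Rightarrow> 'm"  \<comment> \<open>\<open>Comp C g f\<close> is \<open>g\<close> after \<open>f\<close>\<close>

definition hom :: "('o, 'm) cat \<Rightarrow> 'o \<Rightarrow> 'o \<Rightarrow> 'm set" where
  "hom C A B = {f \<in> Arr C. Dom C f = A \<and> Cod C f = B}"

locale category =
  fixes C :: "('o, 'm) cat"
  assumes dom_obj: "f \<in> Arr C \<Longrightarrow> Dom C f \<in> Obj C"
    and cod_obj: "f \<in> Arr C \<Longrightarrow> Cod C f \<in> Obj C"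
    and ident_hom: "A \<in> Obj C \<Longrightarrow> Ident C A \<in> hom C A A"
    and comp_hom: "f \<in> hom C A B \<Longrightarrow> g \<in> hom C B D \<Longrightarrow> Comp C g f \<in> hom C A D"
    and comp_ident_right: "f \<in> hom C A B \<Longrightarrow> Comp C f (Ident C A) = f"
    and comp_ident_left: "f \<in> hom C A B \<Longrightarrow> Comp C (Ident C B) f = f"
    and comp_assoc: "f \<in> hom C A B \<Longrightarrow> g \<in> hom C B D \<Longrightarrow> h \<in> hom C D E \<Longrightarrow>
      Comp C h (Comp C g f) = Comp C (Comp C h g) f"

locale groupoid = category +
  assumes invertible: "f \<in> hom C A B \<Longrightarrow>
    \<exists>g \<in> hom C B A. Comp C g f = Ident C A \<and> Comp C f g = Ident C B"

section \<open>Functors, adjunctions and coreflective subcategories\<close>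

record ('o, 'm, 'p, 'n) funct =
  ObjMap :: "'o \<Rightarrow> 'p"
  ArrMap :: "'m \<Rightarrow> 'n"

locale cat_functor = C: category C + D: category D
  for C :: "('o, 'm) cat" and D :: "('p, 'n) cat" +
  fixes F :: "('o, 'm, 'p, 'n) funct"
  assumes map_obj: "A \<in> Obj C \<Longrightarrow> ObjMap F A \<in> Obj D"
    and map_hom: "f \<in> hom C A B \<Longrightarrow> ArrMap F f \<in> hom D (ObjMap F A) (ObjMap F B)"
    and map_ident: "A \<in> Obj C \<Longrightarrow> ArrMap F (Ident C A) = Ident D (ObjMap F A)"
    and map_comp: "f \<in> hom C A B \<Longrightarrow> g \<in> hom C B E \<Longrightarrow>
      ArrMap F (Comp C g f) = Comp D (ArrMap F g) (ArrMap F f)"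

definition id_funct :: "('o, 'm, 'o, 'm) funct" where
  "id_funct = \<lparr>ObjMap = (\<lambda>A. A), ArrMap = (\<lambda>f. f)\<rparr>"

definition comp_funct ::
    "('p, 'n, 'q, 'k) funct \<Rightarrow> ('o, 'm, 'p, 'n) funct \<Rightarrow> ('o, 'm, 'q, 'k) funct" where
  "comp_funct G F = \<lparr>ObjMap = (\<lambda>A. ObjMap G (ObjMap F A)), ArrMap = (\<lambda>f. ArrMap G (ArrMap F f))\<rparr>"

locale nat_trans = F: cat_functor C D F + G: cat_functor C D G
  for C :: "('o, 'm) cat" and D :: "('p, 'n) cat" and F G +
  fixes \<tau> :: "'o \<Rightarrow> 'n"
  assumes component: "A \<in> Obj C \<Longrightarrow> \<tau> A \<in> hom D (ObjMap F A) (ObjMap G A)"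
    and natural: "f \<in> hom C A B \<Longrightarrow>
      Comp D (\<tau> B) (ArrMap F f) = Comp D (ArrMap G f) (\<tau> A)"

text \<open>\<open>L : C \<rightarrow> D\<close> is left adjoint to \<open>R : D \<rightarrow> C\<close>, with unit \<open>\<eta>\<close> and counit \<open>\<epsilon>\<close>
  satisfying the triangle identities.\<close>

locale adjunction = L: cat_functor C D L + R: cat_functor D C R +
    unit: nat_trans C C id_funct "comp_funct R L" \<eta> +
    counit: nat_trans D D "comp_funct L R" id_funct \<epsilon>
  for C :: "('o, 'm) cat" and D :: "('p, 'n) cat" and L R \<eta> \<epsilon> +
  assumes triangle_left: "A \<in> Obj C \<Longrightarrow>
      Comp D (\<epsilon> (ObjMap L A)) (ArrMap L (\<eta> A)) = Ident D (ObjMap L A)"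
    and triangle_right: "B \<in> Obj D \<Longrightarrow>
      Comp C (ArrMap R (\<epsilon> B)) (\<eta> (ObjMap R B)) = Ident C (ObjMap R B)"

definition has_right_adjoint ::
    "('o, 'm) cat \<Rightarrow> ('p, 'n) cat \<Rightarrow> ('o, 'm, 'p, 'n) funct \<Rightarrow> bool" where
  "has_right_adjoint C D L \<longleftrightarrow> (\<exists>R \<eta> \<epsilon>. adjunction C D L R \<eta> \<epsilon>)"

text \<open>Subcategories are neither assumed full nor replete.\<close>

locale subcategory = S: category S + C: category C
  for S C :: "('o, 'm) cat" +
  assumes obj_subset: "Obj S \<subseteq> Obj C"
    and arr_subset: "Arr S \<subseteq> Arr C"
    and dom_eq: "f \<in> Arr S \<Longrightarrow> Dom S f = Dom C f"
    and cod_eq: "f \<in> Arr S \<Longrightarrow> Cod S f = Cod C f"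
    and ident_eq: "A \<in> Obj S \<Longrightarrow> Ident S A = Ident C A"
    and comp_eq: "f \<in> hom S A B \<Longrightarrow> g \<in> hom S B D \<Longrightarrow> Comp S g f = Comp C g f"

lemma (in subcategory) inclusion_functor: "cat_functor S C id_funct"
proof -
  have h: "hom S A B \<subseteq> hom C A B" for A B
    using arr_subset dom_eq cod_eq by (auto simp: hom_def)
  show ?thesis
    by unfold_locales (use obj_subset h ident_eq comp_eq in \<open>auto simp: id_funct_def\<close>)
qed

text \<open>The inclusion functor of a subcategory is the identity on the underlying types.\<close>

definition coreflective_subcategory :: "('o, 'm) cat \<Rightarrow> ('o, 'm) cat \<Rightarrow> bool" where
  "coreflective_subcategory S C \<longleftrightarrow> subcategory S C \<and> has_right_adjoint S C id_funct"

section \<open>Simplicial sets and duplicial structures\<close>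

record 'x sset =
  Splx :: "nat \<Rightarrow> 'x set"
  face :: "nat \<Rightarrow> nat \<Rightarrow> 'x \<Rightarrow> 'x"  \<comment> \<open>\<open>face X n i\<close> is \<open>d\<^sub>i\<close> on \<open>X\<^sub>n\<close>, for \<open>n \<ge> 1\<close>\<close>
  degen :: "nat \<Rightarrow> nat \<Rightarrow> 'x \<Rightarrow> 'x"  \<comment> \<open>\<open>degen X n j\<close> is \<open>s\<^sub>j\<close> on \<open>X\<^sub>n\<close>\<close>

locale simplicial_set =
  fixes X :: "'x sset"
  assumes face_mem: "x \<in> Splx X n \<Longrightarrow> 1 \<le> n \<Longrightarrow> i \<le> n \<Longrightarrow> face X n i x \<in> Splx X (n - 1)"
    and degen_mem: "x \<in> Splx X n \<Longrightarrow> j \<le> n \<Longrightarrow> degen X n j x \<in> Splx X (n + 1)"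
    and face_face: "x \<in> Splx X n \<Longrightarrow> 2 \<le> n \<Longrightarrow> i < j \<Longrightarrow> j \<le> n \<Longrightarrow>
      face X (n - 1) i (face X n j x) = face X (n - 1) (j - 1) (face X n i x)"
    and degen_degen: "x \<in> Splx X n \<Longrightarrow> i \<le> j \<Longrightarrow> j \<le> n \<Longrightarrow>
      degen X (n + 1) i (degen X n j x) = degen X (n + 1) (j + 1) (degen X n i x)"
    and face_degen_less: "x \<in> Splx X n \<Longrightarrow> i < j \<Longrightarrow> j \<le> n \<Longrightarrow>
      face X (n + 1) i (degen X n j x) = degen X (n - 1) (j - 1) (face X n i x)"
    and face_degen_eq: "x \<in> Splx X n \<Longrightarrow> j \<le> n \<Longrightarrow> i = j \<or> i = j + 1 \<Longrightarrow>
      face X (n + 1) i (degen X n j x) = x"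
    and face_degen_greater: "x \<in> Splx X n \<Longrightarrow> j + 1 < i \<Longrightarrow> i \<le> n + 1 \<Longrightarrow>
      face X (n + 1) i (degen X n j x) = degen X (n - 1) j (face X n (i - 1) x)"

locale duplicial_structure = simplicial_set X for X :: "'x sset" +
  fixes t :: "nat \<Rightarrow> 'x \<Rightarrow> 'x"
  assumes t_mem: "x \<in> Splx X n \<Longrightarrow> t n x \<in> Splx X n"
    and face_t: "x \<in> Splx X n \<Longrightarrow> 1 \<le> i \<Longrightarrow> i \<le> n \<Longrightarrow>
      face X n i (t n x) = t (n - 1) (face X n (i - 1) x)"
    and face_0_t: "x \<in> Splx X n \<Longrightarrow> 1 \<le> n \<Longrightarrow> face X n 0 (t n x) = face X n n x"
    and degen_t: "x \<in> Splx X n \<Longrightarrow> 1 \<le> j \<Longrightarrow> j \<le> n \<Longrightarrow>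
      degen X n j (t n x) = t (n + 1) (degen X n (j - 1) x)"
    and degen_0_t: "x \<in> Splx X n \<Longrightarrow>
      degen X n 0 (t n x) = t (n + 1) (t (n + 1) (degen X n n x))"

section \<open>The nerve\<close>

text \<open>An \<open>n\<close>-simplex \<open>A\<^sub>0 \<rightarrow> \<dots> \<rightarrow> A\<^sub>n\<close> is encoded as the pair of the list
  \<open>[A\<^sub>0, \<dots>, A\<^sub>n]\<close> and the list \<open>[f\<^sub>0, \<dots>, f\<^sub>n\<^sub>-\<^sub>1]\<close>; the conventional notation
  \<open>(f\<^sub>n\<^sub>-\<^sub>1, \<dots>, f\<^sub>0)\<close> lists the morphisms in the opposite order.\<close>

definition nerve_splx :: "('o, 'm) cat \<Rightarrow> nat \<Rightarrow> ('o list \<times> 'm list) set" where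
  "nerve_splx C n = {(as, fs). length as = n + 1 \<and> length fs = n \<and> set as \<subseteq> Obj C \<and>
     (\<forall>i < n. fs ! i \<in> hom C (as ! i) (as ! (i + 1)))}"

definition nerve_face ::
    "('o, 'm) cat \<Rightarrow> nat \<Rightarrow> nat \<Rightarrow> 'o list \<times> 'm list \<Rightarrow> 'o list \<times> 'm list" where
  "nerve_face C n i = (\<lambda>(as, fs).
     (take i as @ drop (i + 1) as,
      if i = 0 then tl fs
      else if i = n then butlast fs
      else take (i - 1) fs @ [Comp C (fs ! i) (fs ! (i - 1))] @ drop (i + 1) fs))"

definition nerve_degen ::
    "('o, 'm) cat \<Rightarrow> nat \<Rightarrow> nat \<Rightarrow> 'o list \<times> 'm list \<Rightarrow> 'o list \<times> 'm list" where
  "nerve_degen C n j = (\<lambda>(as, fs).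
     (take (j + 1) as @ drop j as,
      take j fs @ [Ident C (as ! j)] @ drop j fs))"

definition nerve :: "('o, 'm) cat \<Rightarrow> ('o list \<times> 'm list) sset" where
  "nerve C = \<lparr>Splx = nerve_splx C, face = nerve_face C, degen = nerve_degen C\<rparr>"


lemma nerve_face_nth:
  assumes "(as, fs) \<in> nerve_splx C n" "1 \<le> n" "i \<le> n"
  shows "nerve_face C n i (as, fs) =
    (map (\<lambda>k. if k < i then as ! k else as ! Suc k) [0..<n],
     map (\<lambda>k. if Suc k < i then fs ! k
       else if Suc k = i then Comp C (fs ! Suc k) (fs ! k) else fs ! Suc k) [0..<n - 1])"
proof -
  have l: "length as = Suc n" "length fs = n"
    using assms by (auto simp: nerve_splx_def)
  have "take i as @ drop (i + 1) as =
      map (\<lambda>k. if k < i then as ! k else as ! Suc k) [0..<n]"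
    by (rule nth_equalityI) (use l assms in \<open>auto simp: nth_append\<close>)
  moreover have "(if i = 0 then tl fs else if i = n then butlast fs
      else take (i - 1) fs @ [Comp C (fs ! i) (fs ! (i - 1))] @ drop (i + 1) fs) =
    map (\<lambda>k. if Suc k < i then fs ! k
       else if Suc k = i then Comp C (fs ! Suc k) (fs ! k) else fs ! Suc k) [0..<n - 1]"
    (is "?l = ?r")
  proof -
    consider "i = 0" | "i \<noteq> 0" "i = n" | i' where "i = Suc i'" "i < n"
      using le_neq_implies_less[OF assms(3)] by (cases i) auto
    then show ?thesis
    proof cases
      case 1
      then show ?thesis
        using l by (auto intro!: nth_equalityI simp: nth_tl)
    next
      case 2
      then show ?thesis
        using l by (auto intro!: nth_equalityI simp: nth_butlast)
    next
      case 3
      have "?l ! k = ?r ! k" if "k < n - 1" for k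
        using 3 l that by (cases "k < i'"; cases "k = i'") (auto simp: nth_append)
      then show ?thesis
        using 3 l by (intro nth_equalityI) auto
    qed
  qed
  ultimately show ?thesis
    by (simp add: nerve_face_def)
qed

lemma nerve_degen_nth:
  assumes "(as, fs) \<in> nerve_splx C n" "j \<le> n"
  shows "nerve_degen C n j (as, fs) =
    (map (\<lambda>k. if k \<le> j then as ! k else as ! (k - 1)) [0..<n + 2],
     map (\<lambda>k. if k < j then fs ! k
       else if k = j then Ident C (as ! k) else fs ! (k - 1)) [0..<n + 1])"
proof -
  have l: "length as = Suc n" "length fs = n"
    using assms by (auto simp: nerve_splx_def)
  have "take (j + 1) as @ drop j as =
      map (\<lambda>k. if k \<le> j then as ! k else as ! (k - 1)) [0..<n + 2]"
    by (rule nth_equalityI) (use l assms in \<open>auto simp: nth_append simp del: upt_Suc\<close>)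
  moreover have "take j fs @ [Ident C (as ! j)] @ drop j fs =
    map (\<lambda>k. if k < j then fs ! k
       else if k = j then Ident C (as ! k) else fs ! (k - 1)) [0..<n + 1]"
    by (rule nth_equalityI)
      (use l assms in \<open>auto simp: nth_append nth_Cons simp del: upt_Suc split: nat.splits
        intro!: arg_cong[where f = "(!) fs"]\<close>)
  ultimately show ?thesis
    by (simp add: nerve_degen_def)
qed

lemma nerve_splx_iff:
  "(as, fs) \<in> nerve_splx C n \<longleftrightarrow> length as = Suc n \<and> length fs = n \<and>
     (\<forall>k \<le> n. as ! k \<in> Obj C) \<and> (\<forall>k < n. fs ! k \<in> hom C (as ! k) (as ! Suc k))"
  by (auto simp: nerve_splx_def subset_eq all_set_conv_all_nth less_Suc_eq_le)

context category
begin

lemma nerve_face_mem: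
  assumes x: "x \<in> nerve_splx C n" and n: "1 \<le> n" and i: "i \<le> n"
  shows "nerve_face C n i x \<in> nerve_splx C (n - 1)"
proof -
  obtain as fs where x': "x = (as, fs)" by (cases x)
  note s = x[unfolded x' nerve_splx_iff]
  have "Comp C (fs ! Suc k) (fs ! k) \<in> hom C (as ! k) (as ! Suc (Suc k))" if "Suc k < n" for k
    using s that by (intro comp_hom[of _ _ "as ! Suc k"]) auto
  then show ?thesis
    unfolding x' nerve_face_nth[OF x[unfolded x'] n i] nerve_splx_iff
    using s n i by auto
qed

lemma nerve_degen_mem:
  assumes x: "x \<in> nerve_splx C n" and j: "j \<le> n"
  shows "nerve_degen C n j x \<in> nerve_splx C (n + 1)"
proof -
  obtain as fs where x': "x = (as, fs)" by (cases x)
  note s = x[unfolded x' nerve_splx_iff]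
  have a: "fs ! (k - Suc 0) \<in> hom C (as ! (k - Suc 0)) (as ! k)" if "j < k" "k < Suc n" for k
    using s that by (cases k) auto
  show ?thesis
    unfolding x' nerve_degen_nth[OF x[unfolded x'] j] nerve_splx_iff
    using s j a by (auto simp: ident_hom simp del: upt_Suc)
qed

lemma nerve_simplicial_set: "simplicial_set (nerve C)"
proof (unfold_locales, unfold nerve_def sset.simps)
  fix x n i assume "x \<in> nerve_splx C n" "1 \<le> n" "i \<le> n"
  then show "nerve_face C n i x \<in> nerve_splx C (n - 1)" by (rule nerve_face_mem)
next
  fix x n j assume "x \<in> nerve_splx C n" "j \<le> n"
  then show "nerve_degen C n j x \<in> nerve_splx C (n + 1)" by (rule nerve_degen_mem)
next
  fix x n i j assume x: "x \<in> nerve_splx C n" and n: "2 \<le> n" and ij: "i < j" "j \<le> n"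
  obtain as fs where x': "x = (as, fs)" by (cases x)
  note s = x[unfolded x' nerve_splx_iff]
  have n': "1 \<le> n" "1 \<le> n - 1" "i \<le> n" "i \<le> n - 1" "j - 1 \<le> n - 1"
    using n ij by auto
  obtain j' where j': "j = Suc j'" using ij by (cases j) auto
  define A where "A i = map (\<lambda>k. if k < i then as ! k else as ! Suc k) [0..<n]" for i
  define G where "G i = map (\<lambda>k. if Suc k < i then fs ! k
    else if Suc k = i then Comp C (fs ! Suc k) (fs ! k) else fs ! Suc k) [0..<n - 1]" for i
  have A: "A i ! k = (if k < i then as ! k else as ! Suc k)" if "k < n" for i k
    using that by (simp add: A_def del: upt_Suc)
  have G: "G i ! k = (if Suc k < i then fs ! k
    else if Suc k = i then Comp C (fs ! Suc k) (fs ! k) else fs ! Suc k)" if "k < n - 1" for i k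
    using that by (simp add: G_def del: upt_Suc)
  have fi: "nerve_face C n i (as, fs) = (A i, G i)" and fj: "nerve_face C n j (as, fs) = (A j, G j)"
    unfolding A_def G_def by (intro nerve_face_nth x[unfolded x'] n' ij)+
  note mi = nerve_face_mem[OF x[unfolded x'] n'(1,3), unfolded fi]
    and mj = nerve_face_mem[OF x[unfolded x'] n'(1) ij(2), unfolded fj]
  have a: "Comp C (fs ! Suc (Suc k)) (Comp C (fs ! Suc k) (fs ! k)) =
      Comp C (Comp C (fs ! Suc (Suc k)) (fs ! Suc k)) (fs ! k)" if "Suc (Suc k) < n" for k
    using s that
    by (intro comp_assoc[of _ "as ! k" "as ! Suc k" _ "as ! Suc (Suc k)" _ "as ! Suc (Suc (Suc k))"]) auto
  show "nerve_face C (n - 1) i (nerve_face C n j x) = nerve_face C (n - 1) (j - 1) (nerve_face C n i x)"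
    unfolding x' fi fj nerve_face_nth[OF mj n'(2,4)] nerve_face_nth[OF mi n'(2,5)] prod.inject
  proof (intro conjI map_cong refl)
    fix k assume "k \<in> set [0..<n - 1]"
    then have k: "k < n" "Suc k < n" by auto
    consider "k < i" | "i \<le> k" "k < j'" | "j' \<le> k" by linarith
    then show "(if k < i then A j ! k else A j ! Suc k) =
        (if k < j - 1 then A i ! k else A i ! Suc k)"
      using ij unfolding j' A[OF k(1)] A[OF k(2)] by cases auto
  next
    fix k assume "k \<in> set [0..<n - 1 - 1]"
    then have k: "k < n - 1" "Suc k < n - 1" "Suc (Suc k) < n" by auto
    consider "Suc k < i" | "Suc k = i" "i = j'" | "Suc k = i" "i < j'"
      | "i \<le> k" "Suc k < j'" | "i \<le> k" "Suc k = j'" | "j' \<le> k"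
      using ij j' by linarith
    then show "(if Suc k < i then G j ! k
        else if Suc k = i then Comp C (G j ! Suc k) (G j ! k) else G j ! Suc k) =
      (if Suc k < j - 1 then G i ! k
        else if Suc k = j - 1 then Comp C (G i ! Suc k) (G i ! k) else G i ! Suc k)"
      using ij unfolding j' G[OF k(1)] G[OF k(2)] by cases (use a[OF k(3)] in auto)
  qed
next
  fix x n i j assume x: "x \<in> nerve_splx C n" and ij: "i \<le> j" "j \<le> n"
  obtain as fs where x': "x = (as, fs)" by (cases x)
  have n': "i \<le> n" "i \<le> n + 1" "j + 1 \<le> n + 1"
    using ij by auto
  note fi = nerve_degen_nth[OF x[unfolded x'] n'(1)]
    and fj = nerve_degen_nth[OF x[unfolded x'] ij(2)]
  note mi = nerve_degen_mem[OF x[unfolded x'] n'(1), unfolded fi]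
    and mj = nerve_degen_mem[OF x[unfolded x'] ij(2), unfolded fj]
  show "nerve_degen C (n + 1) i (nerve_degen C n j x) =
      nerve_degen C (n + 1) (j + 1) (nerve_degen C n i x)"
    unfolding x' fi fj nerve_degen_nth[OF mj n'(2)] nerve_degen_nth[OF mi n'(3)]
    using ij by (auto simp del: upt_Suc)
next
  fix x n i j assume x: "x \<in> nerve_splx C n" and ij: "i < j" "j \<le> n"
  obtain as fs where x': "x = (as, fs)" by (cases x)
  have n': "1 \<le> n" "i \<le> n" "1 \<le> n + 1" "i \<le> n + 1" "j - 1 \<le> n - 1"
    using ij by auto
  note fi = nerve_face_nth[OF x[unfolded x'] n'(1,2)]
    and fj = nerve_degen_nth[OF x[unfolded x'] ij(2)]
  note mi = nerve_face_mem[OF x[unfolded x'] n'(1,2), unfolded fi]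
    and mj = nerve_degen_mem[OF x[unfolded x'] ij(2), unfolded fj]
  show "nerve_face C (n + 1) i (nerve_degen C n j x) =
      nerve_degen C (n - 1) (j - 1) (nerve_face C n i x)"
    unfolding x' fi fj nerve_face_nth[OF mj n'(3,4)] nerve_degen_nth[OF mi n'(5)]
    using ij by (auto simp del: upt_Suc)
next
  fix x n i j assume x: "x \<in> nerve_splx C n" and j: "j \<le> n" and i: "i = j \<or> i = j + 1"
  obtain as fs where x': "x = (as, fs)" by (cases x)
  note s = x[unfolded x' nerve_splx_iff]
  have n': "1 \<le> n + 1" "i \<le> n + 1"
    using i j by auto
  note fj = nerve_degen_nth[OF x[unfolded x'] j]
  note mj = nerve_degen_mem[OF x[unfolded x'] j, unfolded fj]
  have a: "Comp C (Ident C (as ! Suc k)) (fs ! k) = fs ! k"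
    "Comp C (fs ! k) (Ident C (as ! k)) = fs ! k" if "k < n" for k
    using s that comp_ident_left comp_ident_right by blast+
  show "nerve_face C (n + 1) i (nerve_degen C n j x) = x"
    unfolding x' fj nerve_face_nth[OF mj n']
    using i j s by (auto simp: a simp del: upt_Suc intro!: nth_equalityI)
next
  fix x n i j assume x: "x \<in> nerve_splx C n" and ij: "j + 1 < i" "i \<le> n + 1"
  obtain as fs where x': "x = (as, fs)" by (cases x)
  have n': "1 \<le> n" "i - 1 \<le> n" "1 \<le> n + 1" "j \<le> n" "j \<le> n - 1"
    using ij by auto
  note fi = nerve_face_nth[OF x[unfolded x'] n'(1,2)]
    and fj = nerve_degen_nth[OF x[unfolded x'] n'(4)]
  note mi = nerve_face_mem[OF x[unfolded x'] n'(1,2), unfolded fi]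
    and mj = nerve_degen_mem[OF x[unfolded x'] n'(4), unfolded fj]
  show "nerve_face C (n + 1) i (nerve_degen C n j x) =
      nerve_degen C (n - 1) j (nerve_face C n (i - 1) x)"
    unfolding x' fi fj nerve_face_nth[OF mj n'(3) ij(2)] nerve_degen_nth[OF mi n'(5)]
    using ij by (auto simp del: upt_Suc)
qed

end

end

theory Submission
  imports Defs
begin

text \<open>
  A duplicial structure \<open>u\<close> on a nerve reduces to data in low dimensions.  In dimension 0 it is
  a map \<open>T\<close> on objects.  In dimension 1 it takes an arrow
  \<open>f : A \<rightarrow> B\<close> to an arrow \<open>t f : T B \<rightarrow> A\<close>, the domain and codomain being forced by the
  identities for \<open>d\<^sub>1 u\<close> and \<open>d\<^sub>0 u\<close>.  In dimension 2 the outer faces force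
  \<open>u (g, f) = (f, t (g f))\<close>, and the inner face gives \<open>f \<circ> t (g f) = t g\<close>.  Finally
  \<open>s\<^sub>0 u = u\<^sup>2 s\<^sub>0\<close> on objects says \<open>t (t 1) = 1\<close>.  The locale \<open>cyclic_operator\<close> records a
  pair \<open>(T, t)\<close> with these properties.  Such a pair suffices:
  \<open>(f\<^sub>n\<^sub>-\<^sub>1, \<dots>, f\<^sub>0) \<mapsto> (f\<^sub>n\<^sub>-\<^sub>2, \<dots>, f\<^sub>0, t (f\<^sub>n\<^sub>-\<^sub>1 \<cdots> f\<^sub>0))\<close> is a duplicial structure
  (\<open>shift_duplicial\<close>).  It remains to match cyclic operators with coreflective groupoids.

  Given a cyclic operator, put \<open>\<epsilon> A = t 1 : T A \<rightarrow> A\<close>.  The two-fold application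
  \<open>f \<mapsto> t (t f) : T A \<rightarrow> T B\<close> is a functor, \<open>\<epsilon>\<close> is a natural transformation from it to the
  identity, and \<open>\<epsilon> (T A)\<close> is invertible.  So \<open>T\<close> is a coreflector onto the full subcategory of
  the objects \<open>A\<close> with \<open>\<epsilon> A\<close> invertible.  That subcategory is a groupoid because
  \<open>f \<circ> t f = \<epsilon> B\<close> for every \<open>f : A \<rightarrow> B\<close>: each of its arrows has a right inverse, which again
  has a right inverse.

  Given a coreflective groupoid with coreflector \<open>R\<close> and counit \<open>\<epsilon>\<close>, the
  arrows \<open>R f\<close> are invertible and \<open>t f = \<epsilon> A \<circ> (R f)\<inverse>\<close> is a cyclic operator
  (\<open>cyclic_operator_of_coreflective_groupoid\<close>).
\<close>

section \<open>Inverses and functors\<close>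

definition inverse_arrows :: "('o, 'm) cat \<Rightarrow> 'm \<Rightarrow> 'm \<Rightarrow> bool" where
  "inverse_arrows C f g \<longleftrightarrow> f \<in> Arr C \<and> g \<in> hom C (Cod C f) (Dom C f) \<and>
     Comp C g f = Ident C (Dom C f) \<and> Comp C f g = Ident C (Cod C f)"

definition inverse_arrow :: "('o, 'm) cat \<Rightarrow> 'm \<Rightarrow> 'm" where
  "inverse_arrow C f = (SOME g. inverse_arrows C f g)"

lemma inverse_arrow_props:
  assumes "\<exists>g. inverse_arrows C f g" and "f \<in> hom C A B"
  shows "inverse_arrow C f \<in> hom C B A"
    and "Comp C (inverse_arrow C f) f = Ident C A"
    and "Comp C f (inverse_arrow C f) = Ident C B"
  using someI_ex[OF assms(1)] assms(2)
  by (auto simp: inverse_arrow_def inverse_arrows_def hom_def)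

context category
begin

lemma hom_objs: "f \<in> hom C A B \<Longrightarrow> A \<in> Obj C \<and> B \<in> Obj C"
  using dom_obj cod_obj by (auto simp: hom_def)

lemma right_inverse_unique:
  assumes "\<exists>g. inverse_arrows C f g" and f: "f \<in> hom C A B" and h: "h \<in> hom C B A"
    and fh: "Comp C f h = Ident C B"
  shows "h = inverse_arrow C f"
proof -
  note i = inverse_arrow_props[OF assms(1) f]
  have "h = Comp C (Comp C (inverse_arrow C f) f) h"
    using i h comp_ident_left by simp
  also have "\<dots> = inverse_arrow C f"
    using comp_assoc[OF h f i(1)] fh i(1) comp_ident_right by simp
  finally show ?thesis .
qed

lemma right_inverse_chain_invertible:
  assumes f: "f \<in> hom C A B" and g: "g \<in> hom C B A" and h: "h \<in> hom C A B"
    and fg: "Comp C f g = Ident C B" and gh: "Comp C g h = Ident C A"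
  shows "Comp C g f = Ident C A"
proof -
  have "h = Comp C (Comp C f g) h"
    using fg h comp_ident_left by simp
  also have "\<dots> = f"
    using comp_assoc[OF h g f] gh f comp_ident_right by simp
  finally show ?thesis using gh by simp
qed

end

lemma (in category) id_functor: "cat_functor C C id_funct"
  by unfold_locales (auto simp: id_funct_def)

lemma comp_functor:
  assumes "cat_functor C D F" and "cat_functor D E G"
  shows "cat_functor C E (comp_funct G F)"
proof -
  interpret F: cat_functor C D F by fact
  interpret G: cat_functor D E G by fact
  show ?thesis
  proof unfold_locales
    fix f A B g D' assume f: "f \<in> hom C A B" and g: "g \<in> hom C B D'"
    show "ArrMap (comp_funct G F) (Comp C g f) =
        Comp E (ArrMap (comp_funct G F) g) (ArrMap (comp_funct G F) f)"
      using F.map_comp[OF f g] G.map_comp[OF F.map_hom[OF f] F.map_hom[OF g]]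
      by (simp add: comp_funct_def)
  qed (simp_all add: comp_funct_def F.map_obj G.map_obj F.map_hom G.map_hom F.map_ident G.map_ident)
qed

section \<open>The coreflective groupoid of a cyclic operator\<close>

text \<open>The trace of a duplicial structure on the nerve in dimensions 0 and 1; \<open>t_comp\<close> is the
  inner face identity in dimension 2.\<close>

locale cyclic_operator = category C for C :: "('o, 'm) cat" +
  fixes T :: "'o \<Rightarrow> 'o" and t :: "'m \<Rightarrow> 'm"
  assumes t_hom: "f \<in> hom C A B \<Longrightarrow> t f \<in> hom C (T B) A"
    and t_comp: "f \<in> hom C A B \<Longrightarrow> g \<in> hom C B D \<Longrightarrow> Comp C f (t (Comp C g f)) = t g"
    and t_t_ident: "A \<in> Obj C \<Longrightarrow> t (t (Ident C A)) = Ident C (T A)"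
begin

abbreviation \<epsilon> :: "'o \<Rightarrow> 'm" where
  "\<epsilon> A \<equiv> t (Ident C A)"

lemma counit_hom: "A \<in> Obj C \<Longrightarrow> \<epsilon> A \<in> hom C (T A) A"
  using t_hom ident_hom by blast

lemma T_obj: "A \<in> Obj C \<Longrightarrow> T A \<in> Obj C"
  using counit_hom hom_objs by blast

lemma comp_t: "f \<in> hom C A B \<Longrightarrow> Comp C f (t f) = \<epsilon> B"
  using t_comp[of f A B "Ident C B" B] ident_hom comp_ident_left hom_objs by metis

lemma tt_hom: "f \<in> hom C A B \<Longrightarrow> t (t f) \<in> hom C (T A) (T B)"
  using t_hom by blast

text \<open>Three uses of \<open>t_comp\<close>: the first gives \<open>f \<circ> t (g f) = t g\<close>, the second, for the composable
  pair \<open>t (g f)\<close>, \<open>f\<close>, gives \<open>t (g f) \<circ> t (t g) = t f\<close>, and the third, for the pair \<open>t (t g)\<close>,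
  \<open>t (g f)\<close>, gives functoriality.\<close>

lemma tt_comp:
  assumes f: "f \<in> hom C A B" and g: "g \<in> hom C B D"
  shows "t (t (Comp C g f)) = Comp C (t (t g)) (t (t f))"
proof -
  have k: "t (Comp C g f) \<in> hom C (T D) A" using t_hom comp_hom[OF f g] .
  have "Comp C (t (Comp C g f)) (t (t g)) = t f"
    using t_comp[OF k f] t_comp[OF f g] by simp
  then show ?thesis
    using t_comp[OF tt_hom[OF g] k] by simp
qed

text \<open>Both sides equal \<open>f \<circ> t f \<circ> t (t f)\<close>, by \<open>comp_t\<close> for \<open>f\<close> and for \<open>t f\<close>.\<close>

lemma counit_natural:
  assumes f: "f \<in> hom C A B"
  shows "Comp C (\<epsilon> B) (t (t f)) = Comp C f (\<epsilon> A)"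
  using comp_assoc[OF tt_hom[OF f] t_hom[OF f] f] comp_t[OF f] comp_t[OF t_hom[OF f]]
  by simp

text \<open>The comultiplication of the comonad \<open>T\<close> has to be produced from \<open>t\<close> alone: the composite
  \<open>\<epsilon> A \<circ> \<epsilon> (T A) : T (T A) \<rightarrow> A\<close> is taken by \<open>t\<close> to an arrow \<open>T A \<rightarrow> T (T A)\<close>, and this
  is the inverse of \<open>\<epsilon> (T A)\<close>.\<close>

lemma counit_T_invertible:
  assumes A: "A \<in> Obj C"
  shows "\<exists>g. inverse_arrows C (\<epsilon> (T A)) g"
proof -
  note e = counit_hom[OF A] and e' = counit_hom[OF T_obj[OF A]]
  define \<delta> where "\<delta> = t (Comp C (\<epsilon> A) (\<epsilon> (T A)))"
  have d: "\<delta> \<in> hom C (T A) (T (T A))"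
    unfolding \<delta>_def using t_hom comp_hom[OF e' e] .
  have 1: "Comp C (\<epsilon> (T A)) \<delta> = Ident C (T A)"
    unfolding \<delta>_def using t_comp[OF e' e] t_t_ident[OF A] by simp
  have 2: "Comp C \<delta> (\<epsilon> (T A)) = Ident C (T (T A))"
    using t_comp[OF d e'] 1 t_t_ident[OF T_obj[OF A]] by simp
  show ?thesis
    unfolding inverse_arrows_def using 1 2 d e' by (auto simp: hom_def)
qed

definition fixed_obj :: "'o \<Rightarrow> bool" where
  "fixed_obj A \<longleftrightarrow> A \<in> Obj C \<and> (\<exists>g. inverse_arrows C (\<epsilon> A) g)"

definition fixed_subcat :: "('o, 'm) cat" where
  "fixed_subcat = C\<lparr>Obj := {A. fixed_obj A},
     Arr := {f \<in> Arr C. fixed_obj (Dom C f) \<and> fixed_obj (Cod C f)}\<rparr>"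

lemma fixed_subcat_simps [simp]:
  "Obj fixed_subcat = {A. fixed_obj A}"
  "Dom fixed_subcat = Dom C" "Cod fixed_subcat = Cod C"
  "Ident fixed_subcat = Ident C" "Comp fixed_subcat = Comp C"
  "f \<in> hom fixed_subcat A B \<longleftrightarrow> f \<in> hom C A B \<and> fixed_obj A \<and> fixed_obj B"
  by (auto simp: fixed_subcat_def hom_def)

lemma fixed_obj_obj: "fixed_obj A \<Longrightarrow> A \<in> Obj C"
  by (simp add: fixed_obj_def)

lemma fixed_obj_T: "A \<in> Obj C \<Longrightarrow> fixed_obj (T A)"
  using counit_T_invertible T_obj by (simp add: fixed_obj_def)

lemma fixed_subcategory: "subcategory fixed_subcat C"
proof -
  interpret S: category fixed_subcat
  proof (unfold_locales, goal_cases)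
    case 1 then show ?case by (auto simp: fixed_subcat_def)
  next
    case 2 then show ?case by (auto simp: fixed_subcat_def)
  next
    case 3 then show ?case by (auto simp: ident_hom fixed_obj_obj)
  next
    case 4 then show ?case by (auto intro: comp_hom)
  next
    case 5 then show ?case by (auto intro: comp_ident_right)
  next
    case 6 then show ?case by (auto intro: comp_ident_left)
  next
    case 7 then show ?case by (auto intro: comp_assoc)
  qed
  show ?thesis
    by unfold_locales (auto simp: fixed_subcat_def fixed_obj_obj)
qed

abbreviation counit_inv :: "'o \<Rightarrow> 'm" where
  "counit_inv A \<equiv> inverse_arrow C (\<epsilon> A)"

lemma counit_inv:
  assumes "fixed_obj A"
  shows "counit_inv A \<in> hom C A (T A)"
    and "Comp C (counit_inv A) (\<epsilon> A) = Ident C (T A)"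
    and "Comp C (\<epsilon> A) (counit_inv A) = Ident C A"
  using inverse_arrow_props[of C "\<epsilon> A" "T A" A] counit_hom assms
  by (auto simp: fixed_obj_def)

text \<open>Since \<open>f \<circ> t f = \<epsilon> B\<close>, inverting \<open>\<epsilon> B\<close> on the right turns \<open>t f\<close> into a right inverse.\<close>

lemma right_inverse_fixed:
  assumes f: "f \<in> hom C A B" and B: "fixed_obj B"
  shows "\<exists>g \<in> hom C B A. Comp C f g = Ident C B"
proof
  show "Comp C (t f) (counit_inv B) \<in> hom C B A"
    using comp_hom[OF counit_inv(1)[OF B] t_hom[OF f]] .
  show "Comp C f (Comp C (t f) (counit_inv B)) = Ident C B"
    using comp_assoc[OF counit_inv(1)[OF B] t_hom[OF f] f] comp_t[OF f] counit_inv(3)[OF B]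
    by simp
qed

lemma fixed_groupoid: "groupoid fixed_subcat"
proof -
  interpret S: subcategory fixed_subcat C by (rule fixed_subcategory)
  show ?thesis
  proof unfold_locales
    fix f A B assume "f \<in> hom fixed_subcat A B"
    then have f: "f \<in> hom C A B" and A: "fixed_obj A" and B: "fixed_obj B" by auto
    obtain g where g: "g \<in> hom C B A" "Comp C f g = Ident C B"
      using right_inverse_fixed[OF f B] by blast
    obtain h where h: "h \<in> hom C A B" "Comp C g h = Ident C A"
      using right_inverse_fixed[OF g(1) A] by blast
    show "\<exists>g \<in> hom fixed_subcat B A. Comp fixed_subcat g f = Ident fixed_subcat A \<and>
        Comp fixed_subcat f g = Ident fixed_subcat B"
      using right_inverse_chain_invertible[OF f g(1) h(1) g(2) h(2)] g A B by auto
  qed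
qed

definition coreflector :: "('o, 'm, 'o, 'm) funct" where
  "coreflector = \<lparr>ObjMap = T, ArrMap = (\<lambda>f. t (t f))\<rparr>"

lemma counit_inv_natural:
  assumes f: "f \<in> hom C A B" and A: "fixed_obj A" and B: "fixed_obj B"
  shows "Comp C (counit_inv B) f = Comp C (t (t f)) (counit_inv A)"
proof -
  note iA = counit_inv[OF A] and iB = counit_inv[OF B]
  note eA = counit_hom[OF fixed_obj_obj[OF A]] and eB = counit_hom[OF fixed_obj_obj[OF B]]
  let ?m = "Comp C (t (t f)) (counit_inv A)"
  have m: "?m \<in> hom C A (T B)" using comp_hom[OF iA(1) tt_hom[OF f]] .
  have "f = Comp C f (Comp C (\<epsilon> A) (counit_inv A))"
    using iA(3) comp_ident_right[OF f] by simp
  also have "\<dots> = Comp C (Comp C (\<epsilon> B) (t (t f))) (counit_inv A)"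
    using comp_assoc[OF iA(1) eA f] counit_natural[OF f] by simp
  also have "\<dots> = Comp C (\<epsilon> B) ?m"
    using comp_assoc[OF iA(1) tt_hom[OF f] eB] by simp
  finally have "Comp C (counit_inv B) f = Comp C (Comp C (counit_inv B) (\<epsilon> B)) ?m"
    using comp_assoc[OF m eB iB(1)] by simp
  then show ?thesis using iB(2) comp_ident_left[OF m] by simp
qed

text \<open>On the fixed objects the counit is invertible, and its inverse serves as the unit.\<close>

lemma fixed_adjunction:
  "adjunction fixed_subcat C id_funct coreflector counit_inv \<epsilon>"
proof -
  interpret S: subcategory fixed_subcat C by (rule fixed_subcategory)
  have L: "cat_functor fixed_subcat C id_funct" by (rule S.inclusion_functor)
  have R: "cat_functor C fixed_subcat coreflector"
  proof unfold_locales
    fix f A B assume f: "f \<in> hom C A B"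
    show "ArrMap coreflector f \<in> hom fixed_subcat (ObjMap coreflector A) (ObjMap coreflector B)"
      using tt_hom[OF f] hom_objs[OF f] by (simp add: coreflector_def fixed_obj_T)
  qed (auto simp: coreflector_def fixed_obj_T t_t_ident tt_comp)
  have unit: "nat_trans fixed_subcat fixed_subcat id_funct (comp_funct coreflector id_funct) counit_inv"
    unfolding nat_trans_def
  proof (intro conjI S.S.id_functor comp_functor[OF L R], unfold_locales)
    fix A assume "A \<in> Obj fixed_subcat"
    then have A: "fixed_obj A" by simp
    show "counit_inv A \<in>
        hom fixed_subcat (ObjMap id_funct A) (ObjMap (comp_funct coreflector id_funct) A)"
      using counit_inv(1)[OF A] A fixed_obj_T[OF fixed_obj_obj[OF A]]
      by (simp add: id_funct_def comp_funct_def coreflector_def)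
  next
    fix f A B assume "f \<in> hom fixed_subcat A B"
    then have f: "f \<in> hom C A B" "fixed_obj A" "fixed_obj B" by auto
    show "Comp fixed_subcat (counit_inv B) (ArrMap id_funct f) =
        Comp fixed_subcat (ArrMap (comp_funct coreflector id_funct) f) (counit_inv A)"
      using counit_inv_natural[OF f] by (simp add: id_funct_def comp_funct_def coreflector_def)
  qed
  have counit: "nat_trans C C (comp_funct id_funct coreflector) id_funct \<epsilon>"
    unfolding nat_trans_def
  proof (intro conjI id_functor comp_functor[OF R L], unfold_locales)
    fix A assume A: "A \<in> Obj C"
    show "\<epsilon> A \<in> hom C (ObjMap (comp_funct id_funct coreflector) A) (ObjMap id_funct A)"
      using counit_hom[OF A] by (simp add: id_funct_def comp_funct_def coreflector_def)
  next
    fix f A B assume f: "f \<in> hom C A B"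
    show "Comp C (\<epsilon> B) (ArrMap (comp_funct id_funct coreflector) f) =
        Comp C (ArrMap id_funct f) (\<epsilon> A)"
      using counit_natural[OF f] by (simp add: id_funct_def comp_funct_def coreflector_def)
  qed
  show ?thesis
    unfolding adjunction_def
  proof (intro conjI L R unit counit, unfold_locales)
    fix A assume "A \<in> Obj fixed_subcat"
    then have A: "fixed_obj A" by simp
    show "Comp C (\<epsilon> (ObjMap id_funct A)) (ArrMap id_funct (counit_inv A)) =
        Ident C (ObjMap id_funct A)"
      using counit_inv(3)[OF A] by (simp add: id_funct_def)
  next
    fix B assume B: "B \<in> Obj C"
    \<comment> \<open>Both \<open>\<epsilon> (T B)\<close> and the image \<open>t (t (\<epsilon> B))\<close> of \<open>\<epsilon> B\<close> under the coreflector
      equal \<open>t (Ident C (T B))\<close>.\<close>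
    show "Comp fixed_subcat (ArrMap coreflector (\<epsilon> B)) (counit_inv (ObjMap coreflector B)) =
        Ident fixed_subcat (ObjMap coreflector B)"
      using counit_inv(3)[OF fixed_obj_T[OF B]] t_t_ident[OF B] by (simp add: coreflector_def)
  qed
qed

lemma fixed_coreflective: "coreflective_subcategory fixed_subcat C"
  using fixed_subcategory fixed_adjunction
  unfolding coreflective_subcategory_def has_right_adjoint_def by blast

end

section \<open>Cyclic operators from coreflective groupoids\<close>

lemma (in groupoid) ex_inverse_arrows:
  "f \<in> hom C A B \<Longrightarrow> \<exists>g. inverse_arrows C f g"
  using invertible[of f A B] by (auto simp: inverse_arrows_def hom_def)

text \<open>The relation \<open>t_comp\<close> is naturality of the counit, after cancelling \<open>R f\<close> against the factor
  \<open>(R f)\<inverse>\<close> of \<open>(R (g f))\<inverse>\<close>.  For the other relation \<open>t 1 = \<epsilon> A\<close>, so \<open>t (t 1)\<close> is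
  \<open>\<epsilon> (R A) \<circ> (R (\<epsilon> A))\<inverse>\<close>; one triangle identity identifies \<open>(R (\<epsilon> A))\<inverse>\<close> with \<open>\<eta> (R A)\<close>, and
  the other says that the composite is the identity.\<close>

lemma cyclic_operator_of_coreflective_groupoid:
  assumes S: "subcategory S C" and G: "groupoid S" and adj: "adjunction S C id_funct R \<eta> \<epsilon>"
  shows "cyclic_operator C (ObjMap R)
    (\<lambda>f. Comp C (\<epsilon> (Dom C f)) (inverse_arrow S (ArrMap R f)))"
proof -
  interpret subcategory S C by (rule S)
  interpret groupoid S by (rule G)
  interpret adjunction S C id_funct R \<eta> \<epsilon> by (rule adj)
  have sub: "f \<in> hom S A B \<Longrightarrow> f \<in> hom C A B" for f A B
    using arr_subset dom_eq cod_eq by (auto simp: hom_def)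
  note objs = C.hom_objs
  have e: "\<epsilon> A \<in> hom C (ObjMap R A) A" if "A \<in> Obj C" for A
    using counit.component[OF that] by (simp add: id_funct_def comp_funct_def)
  define k where "k f = inverse_arrow S (ArrMap R f)" for f
  have k: "k f \<in> hom S (ObjMap R B) (ObjMap R A)"
    "Comp S (k f) (ArrMap R f) = Ident S (ObjMap R A)"
    "Comp S (ArrMap R f) (k f) = Ident S (ObjMap R B)" if "f \<in> hom C A B" for f A B
    using inverse_arrow_props[OF ex_inverse_arrows] R.map_hom[OF that] by (auto simp: k_def)
  define t where "t f = Comp C (\<epsilon> (Dom C f)) (k f)" for f
  have t: "t f = Comp C (\<epsilon> A) (k f)" if "f \<in> hom C A B" for f A B
    using that by (simp add: t_def hom_def)
  have "cyclic_operator C (ObjMap R) t"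
  proof unfold_locales
    fix f A B assume f: "f \<in> hom C A B"
    show "t f \<in> hom C (ObjMap R B) A"
      using C.comp_hom[OF sub[OF k(1)[OF f]] e] objs[OF f] t[OF f] by simp
  next
    fix f A B g D assume f: "f \<in> hom C A B" and g: "g \<in> hom C B D"
    note gf = C.comp_hom[OF f g] and Rf = R.map_hom[OF f] and Rg = R.map_hom[OF g]
    have A: "A \<in> Obj C" and B: "B \<in> Obj C" using objs[OF f] by auto
    let ?k = "k (Comp C g f)"
    have "Comp S (ArrMap R g) (Comp S (ArrMap R f) ?k) = Ident S (ObjMap R D)"
      using S.comp_assoc[OF k(1)[OF gf] Rf Rg] k(3)[OF gf] R.map_comp[OF f g] by simp
    then have kg: "Comp S (ArrMap R f) ?k = k g"
      unfolding k_def[of g]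
      using S.right_inverse_unique[OF ex_inverse_arrows[OF Rg] Rg S.comp_hom[OF k(1)[OF gf] Rf]]
      by simp
    have "Comp C f (t (Comp C g f)) = Comp C (Comp C f (\<epsilon> A)) ?k"
      using C.comp_assoc[OF sub[OF k(1)[OF gf]] e[OF A] f] t[OF gf] by simp
    also have "Comp C f (\<epsilon> A) = Comp C (\<epsilon> B) (ArrMap R f)"
      using counit.natural[OF f] by (simp add: id_funct_def comp_funct_def)
    also have "Comp C (Comp C (\<epsilon> B) (ArrMap R f)) ?k = Comp C (\<epsilon> B) (Comp S (ArrMap R f) ?k)"
      using C.comp_assoc[OF sub[OF k(1)[OF gf]] sub[OF Rf] e[OF B]] comp_eq[OF k(1)[OF gf] Rf]
      by simp
    also have "\<dots> = t g"
      using kg t[OF g] by simp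
    finally show "Comp C f (t (Comp C g f)) = t g" .
  next
    fix A assume A: "A \<in> Obj C"
    note id = C.ident_hom[OF A] and RA = R.map_obj[OF A]
    have "k (Ident C A) = Ident S (ObjMap R A)"
      using k(1,2)[OF id] R.map_ident[OF A] S.comp_ident_right by simp
    then have tid: "t (Ident C A) = \<epsilon> A"
      using t[OF id] ident_eq[OF RA] C.comp_ident_right[OF e[OF A]] by simp
    have "\<eta> (ObjMap R A) \<in> hom S (ObjMap R A) (ObjMap R (ObjMap R A))"
      using unit.component[OF RA] by (simp add: id_funct_def comp_funct_def)
    then have "\<eta> (ObjMap R A) = k (\<epsilon> A)"
      unfolding k_def
      using S.right_inverse_unique[OF ex_inverse_arrows] R.map_hom[OF e[OF A]] triangle_right[OF A]
      by blast
    then show "t (t (Ident C A)) = Ident C (ObjMap R A)"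
      using tid t[OF e[OF A]] triangle_left[OF RA] by (simp add: id_funct_def)
  qed
  then show ?thesis unfolding t_def k_def .
qed

section \<open>Cyclic operators from duplicial structures\<close>

lemma nerve_simps [simp]:
  "Splx (nerve C) = nerve_splx C" "face (nerve C) = nerve_face C" "degen (nerve C) = nerve_degen C"
  by (simp_all add: nerve_def)

lemma nerve_splx_0: "x \<in> nerve_splx C 0 \<longleftrightarrow> (\<exists>A \<in> Obj C. x = ([A], []))"
  by (auto simp: nerve_splx_def length_Suc_conv)

lemma (in category) nerve_splx_1:
  "x \<in> nerve_splx C (Suc 0) \<longleftrightarrow> (\<exists>A B f. x = ([A, B], [f]) \<and> f \<in> hom C A B)"
  using hom_objs by (auto simp: nerve_splx_def length_Suc_conv)

lemma (in category) nerve_splx_2: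
  "x \<in> nerve_splx C 2 \<longleftrightarrow>
    (\<exists>A B D f g. x = ([A, B, D], [f, g]) \<and> f \<in> hom C A B \<and> g \<in> hom C B D)"
  using hom_objs
  by (auto simp: nerve_splx_def length_Suc_conv numeral_2_eq_2 less_Suc_eq all_conj_distrib)

text \<open>The operator on vertices and edges is read off from dimensions 0 and 1; the faces of a shifted
  2-simplex give \<open>t_comp\<close>, and the degeneracy identity on vertices gives \<open>t_t_ident\<close>.\<close>

lemma cyclic_operator_of_duplicial_structure:
  assumes "category C" and "duplicial_structure (nerve C) u"
  shows "\<exists>T t. cyclic_operator C T t"
proof -
  interpret category C by fact
  interpret duplicial_structure "nerve C" u by fact
  define T where "T A = hd (fst (u 0 ([A], [])))" for A
  define t where "t f = hd (snd (u 1 ([Dom C f, Cod C f], [f])))" for f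
  have u0: "u 0 ([A], []) = ([T A], []) \<and> T A \<in> Obj C" if "A \<in> Obj C" for A
    using t_mem[of "([A], [])" 0] that by (auto simp: nerve_splx_0 T_def)
  have u1: "u 1 ([A, B], [f]) = ([T B, A], [t f]) \<and> t f \<in> hom C (T B) A"
    if f: "f \<in> hom C A B" for f A B
  proof -
    have x: "([A, B], [f]) \<in> Splx (nerve C) 1" using f by (simp add: nerve_splx_1)
    obtain A' B' f' where f': "u 1 ([A, B], [f]) = ([A', B'], [f'])" "f' \<in> hom C A' B'"
      using t_mem[OF x] by (auto simp: nerve_splx_1)
    have "B' = A" using face_0_t[OF x] f' by (simp add: nerve_face_def)
    moreover have "A' = T B"
      using face_t[OF x, of 1] f' u0[of B] hom_objs[OF f] by (simp add: nerve_face_def)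
    moreover have "f' = t f" using f f' by (auto simp: t_def hom_def)
    ultimately show ?thesis using f' by simp
  qed
  have "cyclic_operator C T t"
  proof unfold_locales
    fix f A B assume "f \<in> hom C A B"
    then show "t f \<in> hom C (T B) A" using u1 by blast
  next
    fix f A B g D assume f: "f \<in> hom C A B" and g: "g \<in> hom C B D"
    have x: "([A, B, D], [f, g]) \<in> Splx (nerve C) 2" using f g by (simp add: nerve_splx_2)
    obtain A' B' D' f' g' where
      u: "u 2 ([A, B, D], [f, g]) = ([A', B', D'], [f', g'])" "f' \<in> hom C A' B'" "g' \<in> hom C B' D'"
      using t_mem[OF x] by (auto simp: nerve_splx_2)
    have "g' = f" using face_0_t[OF x] u by (simp add: nerve_face_def)
    moreover have "f' = t (Comp C g f)"
      using face_t[OF x, of 2] u u1[OF comp_hom[OF f g]] by (simp add: nerve_face_def)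
    moreover have "Comp C g' f' = t g"
      using face_t[OF x, of 1] u u1[OF g] by (simp add: nerve_face_def)
    ultimately show "Comp C f (t (Comp C g f)) = t g" by simp
  next
    fix A assume A: "A \<in> Obj C"
    then have x: "([A], []) \<in> Splx (nerve C) 0" by (simp add: nerve_splx_0)
    note id = u1[OF ident_hom[OF A]]
    show "t (t (Ident C A)) = Ident C (T A)"
      using degen_0_t[OF x] u0[OF A] id u1[OF conjunct2[OF id]] by (simp add: nerve_degen_def)
  qed
  then show ?thesis by blast
qed

section \<open>Duplicial structures from cyclic operators\<close>

lemma last_face:
  assumes x: "(as, fs) \<in> nerve_splx C n" and n: "1 \<le> n"
  shows "nerve_face C n n (as, fs) = (butlast as, butlast fs)"
  using assms by (auto simp: nerve_splx_def nerve_face_def butlast_conv_take)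

text \<open>The starting object is an argument because it determines the value at the empty list.\<close>

fun composite :: "('o, 'm) cat \<Rightarrow> 'o \<Rightarrow> 'm list \<Rightarrow> 'm" where
  "composite C A [] = Ident C A"
| "composite C A (f # fs) = Comp C (composite C (Cod C f) fs) f"

context category
begin

lemma nerve_splx_Cons:
  "(A # as, f # fs) \<in> nerve_splx C (Suc n) \<longleftrightarrow>
    f \<in> hom C A (hd as) \<and> as \<noteq> [] \<and> (as, fs) \<in> nerve_splx C n"
proof (cases as)
  case Nil
  then show ?thesis by (simp add: nerve_splx_def)
next
  case (Cons B bs)
  have "(\<forall>k < Suc n. (f # fs) ! k \<in> hom C ((A # as) ! k) (as ! k)) \<longleftrightarrow>
      f \<in> hom C A B \<and> (\<forall>k < n. fs ! k \<in> hom C (as ! k) (as ! Suc k))"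
    by (simp add: All_less_Suc2 Cons)
  then show ?thesis
    using Cons by (auto simp: nerve_splx_def dest: hom_objs)
qed

lemma composite_hom:
  "(as, fs) \<in> nerve_splx C n \<Longrightarrow> composite C (hd as) fs \<in> hom C (hd as) (last as)"
proof (induction fs arbitrary: as n)
  case Nil
  then show ?case by (auto simp: nerve_splx_def length_Suc_conv ident_hom)
next
  case (Cons f fs)
  then obtain A as' n' where as: "as = A # as'" "n = Suc n'"
    by (auto simp: nerve_splx_def length_Suc_conv)
  then show ?case
    using Cons comp_hom by (fastforce simp: nerve_splx_Cons hom_def)
qed

text \<open>The composite ignores inner faces by associativity, and degeneracies by the unit laws.\<close>

lemma composite_face:
  assumes "(as, fs) \<in> nerve_splx C n" "Suc k < n"
  shows "composite C (hd as) (take k fs @ [Comp C (fs ! Suc k) (fs ! k)] @ drop (k + 2) fs) =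
    composite C (hd as) fs"
  using assms
proof (induction k arbitrary: as fs n)
  case 0
  then obtain m where m: "n = Suc (Suc m)"
    by (metis less_imp_Suc_add add_Suc)
  with 0 obtain A B as' f g fs' where l: "as = A # B # as'" "fs = f # g # fs'"
    by (auto simp: nerve_splx_def length_Suc_conv)
  then have f: "f \<in> hom C A B" and g: "g \<in> hom C B (hd as')" and r: "(as', fs') \<in> nerve_splx C m"
    using 0 m by (auto simp: nerve_splx_Cons)
  show ?case
    using comp_assoc[OF f g composite_hom[OF r]] comp_hom[OF f g] f g l by (simp add: hom_def)
next
  case (Suc k)
  then obtain m where m: "n = Suc m"
    by (cases n) auto
  with Suc.prems obtain A as' f fs' where l: "as = A # as'" "fs = f # fs'"
    by (auto simp: nerve_splx_def length_Suc_conv)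
  then show ?case
    using Suc.IH[of as' fs' m] Suc.prems m by (auto simp: nerve_splx_Cons hom_def)
qed

lemma composite_degen:
  assumes "(as, fs) \<in> nerve_splx C n" "j \<le> n"
  shows "composite C (hd as) (take j fs @ [Ident C (as ! j)] @ drop j fs) = composite C (hd as) fs"
  using assms
proof (induction j arbitrary: as fs n)
  case 0
  then obtain A as' where l: "as = A # as'" "A \<in> Obj C"
    by (auto simp: nerve_splx_def length_Suc_conv)
  then show ?case
    using comp_ident_right[OF composite_hom[OF 0(1)]] ident_hom[OF l(2)] by (simp add: hom_def)
next
  case (Suc j)
  then obtain m where m: "n = Suc m"
    by (cases n) auto
  with Suc.prems obtain A as' f fs' where l: "as = A # as'" "fs = f # fs'"
    by (auto simp: nerve_splx_def length_Suc_conv)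
  then show ?case
    using Suc.IH[of as' fs' m] Suc.prems m by (auto simp: nerve_splx_Cons hom_def)
qed

end

context cyclic_operator
begin

text \<open>The duplicial operator: the last vertex and the last arrow drop out, and the composite of the
  whole chain comes back at the front through \<open>t\<close>.  On a 0-simplex there is no arrow to replace.\<close>

definition shift :: "'o list \<times> 'm list \<Rightarrow> 'o list \<times> 'm list" where
  "shift = (\<lambda>(as, fs). (T (last as) # butlast as,
     if fs = [] then [] else t (composite C (hd as) fs) # butlast fs))"

lemma shift_mem:
  assumes x: "x \<in> nerve_splx C n"
  shows "shift x \<in> nerve_splx C n"
proof -
  obtain as fs where x': "x = (as, fs)" by (cases x)
  show ?thesis
  proof (cases n)
    case 0
    then show ?thesis using x x' by (auto simp: nerve_splx_0 shift_def T_obj)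
  next
    case (Suc m)
    have "t (composite C (hd as) fs) \<in> hom C (T (last as)) (hd as)"
      using t_hom composite_hom x x' by blast
    moreover have "(butlast as, butlast fs) \<in> nerve_splx C m"
      using nerve_face_mem[OF x, of n] last_face[of as fs C n] x x' Suc by simp
    moreover obtain A B as' f fs' where "as = A # B # as'" "fs = f # fs'"
      using x x' Suc by (auto simp: nerve_splx_def length_Suc_conv)
    ultimately show ?thesis
      using x' Suc by (simp add: shift_def nerve_splx_Cons)
  qed
qed

text \<open>Face \<open>Suc k\<close> of the shifted simplex composes the same two arrows as face \<open>k\<close> of the original
  one, except at the ends: for \<open>k = 0\<close> and \<open>n \<ge> 2\<close> the composition involves the new arrow and
  \<open>t_comp\<close> resolves it; for \<open>Suc k = n\<close> the last face removes the last arrow of the shifted simplex,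
  while on the other side the shift removes the arrow that face \<open>k\<close> has just composed.\<close>

lemma face_shift:
  assumes x: "x \<in> nerve_splx C n" and k: "k < n"
  shows "nerve_face C n (Suc k) (shift x) = shift (nerve_face C n k x)"
proof -
  obtain as fs where x': "x = (as, fs)" by (cases x)
  have l: "length as = Suc n" "length fs = n"
    using x x' by (auto simp: nerve_splx_def)
  let ?c = "composite C (hd as) fs"
  obtain ds gs where f: "nerve_face C n k x = (ds, gs)" by (cases "nerve_face C n k x")
  have ds: "ds = take k as @ drop (Suc k) as"
    using f x' by (simp add: nerve_face_def)
  have objs: "take (Suc k) (T (last as) # butlast as) @ drop (Suc (Suc k)) (T (last as) # butlast as)
      = T (last ds) # butlast ds"
    using k l by (simp add: ds butlast_append take_butlast drop_butlast)
  have arrs: "snd (nerve_face C n (Suc k) (shift x)) = snd (shift (ds, gs))"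
  proof (cases k)
    case 0
    obtain A B as' g fs' where s: "as = A # B # as'" "fs = g # fs'"
      using k l by (cases fs; cases as; cases "tl as") auto
    have "g \<in> hom C A B" "(B # as', fs') \<in> nerve_splx C (n - 1)"
      using x x' s k by (cases n; simp add: nerve_splx_Cons)+
    then have "Comp C g (t (composite C A (g # fs'))) = t (composite C B fs')"
      using t_comp composite_hom[of "B # as'" fs'] by (fastforce simp: hom_def)
    moreover have "gs = fs'" "ds = B # as'"
      using f x' 0 s by (simp_all add: nerve_face_def)
    moreover have "Cod C g = B"
      using \<open>g \<in> hom C A B\<close> by (auto simp: hom_def)
    moreover have "n = Suc (length fs')"
      using l s by simp
    ultimately show ?thesis
      using x' 0 s by (cases fs' rule: rev_cases) (simp_all add: nerve_face_def shift_def)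
  next
    case (Suc m)
    then have gs: "gs = take m fs @ [Comp C (fs ! Suc m) (fs ! m)] @ drop (m + 2) fs"
      using f x' k by (simp add: nerve_face_def)
    have "hd ds = hd as"
      using Suc l k by (cases as) (auto simp: ds)
    then have c: "composite C (hd ds) gs = ?c"
      using composite_face[of as fs n m] x x' Suc k gs by simp
    consider "Suc k = n" | "Suc k < n" using k by linarith
    then show ?thesis
    proof cases
      case 1
      then have "butlast gs = take m fs" "butlast (butlast fs) = take m fs" "butlast fs \<noteq> []"
        using gs Suc l by (auto simp: butlast_conv_take min_def)
      moreover have "fs \<noteq> []" "gs \<noteq> []" using calculation gs by auto
      ultimately show ?thesis
        using x' 1 c by (simp add: nerve_face_def shift_def)
    next
      case 2
      then have "butlast gs =
          take m (butlast fs) @ [Comp C (butlast fs ! Suc m) (butlast fs ! m)] @ drop (m + 2) (butlast fs)"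
        using gs Suc l by (simp add: butlast_append nth_butlast take_butlast drop_butlast)
      moreover have "fs \<noteq> []" "gs \<noteq> []" using gs l k by auto
      ultimately show ?thesis
        using x' 2 c Suc by (simp add: nerve_face_def shift_def)
    qed
  qed
  show ?thesis
    unfolding f by (rule prod_eqI) (use objs arrs x' in \<open>auto simp: nerve_face_def shift_def\<close>)
qed

lemma face_0_shift:
  assumes x: "x \<in> nerve_splx C n" and n: "1 \<le> n"
  shows "nerve_face C n 0 (shift x) = nerve_face C n n x"
proof -
  obtain as fs where x': "x = (as, fs)" by (cases x)
  then have "fs \<noteq> []" using x n by (auto simp: nerve_splx_def)
  then show ?thesis
    using last_face[OF x[unfolded x'] n] x' by (simp add: shift_def nerve_face_def)
qed

lemma degen_shift:
  assumes x: "x \<in> nerve_splx C n" and j: "j < n"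
  shows "nerve_degen C n (Suc j) (shift x) = shift (nerve_degen C n j x)"
proof -
  obtain as fs where x': "x = (as, fs)" by (cases x)
  have l: "length as = Suc n" "length fs = n"
    using x x' by (auto simp: nerve_splx_def)
  have "hd (take (Suc j) as @ drop j as) = hd as"
    using l by (cases as) auto
  then show ?thesis
    using composite_degen[OF x[unfolded x'], of j] x' l j
    by (auto simp: nerve_degen_def shift_def butlast_append take_butlast drop_butlast nth_butlast)
qed

text \<open>Writing \<open>c\<close> for the composite of the chain, the second shift puts \<open>t (c \<circ> t c)\<close> at the front,
  and this is \<open>t (\<epsilon> B) = 1\<close> for the last vertex \<open>B\<close>.\<close>

lemma degen_0_shift:
  assumes x: "x \<in> nerve_splx C n"
  shows "nerve_degen C n 0 (shift x) = shift (shift (nerve_degen C n n x))"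
proof -
  obtain as fs where x': "x = (as, fs)" by (cases x)
  have l: "length as = Suc n" "length fs = n"
    using x x' by (auto simp: nerve_splx_def)
  let ?c = "composite C (hd as) fs"
  have c: "?c \<in> hom C (hd as) (last as)"
    using composite_hom x x' by blast
  have "as ! n = last as" using l by (cases as rule: rev_cases) auto
  then have d: "nerve_degen C n n x = (as @ [last as], fs @ [Ident C (last as)])"
    using l x' by (cases as rule: rev_cases) (auto simp: nerve_degen_def)
  have c': "composite C (hd as) (fs @ [Ident C (last as)]) = ?c"
    using composite_degen[OF x[unfolded x'], of n] l \<open>as ! n = last as\<close> by simp
  have s: "shift (nerve_degen C n n x) = (T (last as) # as, t ?c # fs)"
    using l c' by (cases as) (auto simp: d shift_def)
  have "Cod C (t ?c) = hd as" using t_hom[OF c] by (simp add: hom_def)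
  then have "t (composite C (T (last as)) (t ?c # fs)) = Ident C (T (last as))"
    using comp_t[OF c] t_t_ident hom_objs[OF c] by simp
  then have s': "shift (T (last as) # as, t ?c # fs) =
      (T (last as) # T (last as) # butlast as, Ident C (T (last as)) # butlast (t ?c # fs))"
    using l by (cases as) (simp_all add: shift_def del: composite.simps)
  show ?thesis
    unfolding s s' by (simp add: x' shift_def nerve_degen_def)
qed

lemma shift_duplicial: "duplicial_structure (nerve C) (\<lambda>n. shift)"
proof -
  interpret simplicial_set "nerve C" by (rule nerve_simplicial_set)
  show ?thesis
  proof (unfold_locales, unfold nerve_simps)
    fix x n i assume "x \<in> nerve_splx C n" "1 \<le> i" "i \<le> n"
    then show "nerve_face C n i (shift x) = shift (nerve_face C n (i - 1) x)"
      using face_shift[of x n "i - 1"] by simp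
  next
    fix x n j assume "x \<in> nerve_splx C n" "1 \<le> j" "j \<le> n"
    then show "nerve_degen C n j (shift x) = shift (nerve_degen C n (j - 1) x)"
      using degen_shift[of x n "j - 1"] by simp
  qed (simp_all add: shift_mem face_0_shift degen_0_shift)
qed

end

theorem corollary5p3p14:
  fixes C :: "('o, 'm) cat"
  assumes "category C"
  shows "(\<exists>t. duplicial_structure (nerve C) t) \<longleftrightarrow>
    (\<exists>S. coreflective_subcategory S C \<and> groupoid S)"
proof
  assume "\<exists>t. duplicial_structure (nerve C) t"
  then obtain T t where "cyclic_operator C T t"
    using cyclic_operator_of_duplicial_structure[OF assms] by blast
  then interpret cyclic_operator C T t .
  show "\<exists>S. coreflective_subcategory S C \<and> groupoid S"
    using fixed_coreflective fixed_groupoid by blast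
next
  assume "\<exists>S. coreflective_subcategory S C \<and> groupoid S"
  then obtain T t where "cyclic_operator C T t"
    using cyclic_operator_of_coreflective_groupoid
    unfolding coreflective_subcategory_def has_right_adjoint_def by blast
  then interpret cyclic_operator C T t .
  show "\<exists>t. duplicial_structure (nerve C) t"
    using shift_duplicial by blast
qed

end
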